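(* There exists a uniform constant $C>0$ (it is enough to take $C=2^{-14}$) such that for any integers $n,m\ge 4$ there exists an oriented graph $G=(V,E)$ with $|V|=n$ and $|E|=m$ such that $$\eta(G)\ge C\cdot\bigl(\min(|V|^2,|E|)\cdot\min(|V|,|E|)+|E|\bigr).$$
   Context: An oriented graph $G=(V,E)$ is a pair of finite nonempty sets (vertices and edges) with two functions $t,o:E\to V$ giving the tail (end point) $t(e)$ and the origin (starting point) $o(e)$ of each edge; loops and multiple edges are allowed. A diagram $(G,l)$ over a monoid $M$ is an oriented graph $G$ with a labeling $l:E\to M$. For a finite sequence $s=(e_1,\dots,e_k)$ of edges (not necessarily consecutive) put $l(s)=l(e_1)\cdots l(e_k)$, and $l(())=\mathbf 1_M$ for the empty sequence. A path $p$ is a (possibly empty) edge sequence $(e_1,\dots,e_k)$ with $t(e_i)=o(e_{i+1})$ for $1\le i\le k-1$, together with vertices $o(p),t(p)$ such that $o(p)=o(e_1)$, $t(p)=t(e_k)$ if $k>0$, and $o(p)=t(p)$ if $k=0$ (so there is a path of length zero at every vertex). The diagram is commutative if $l(p_1)=l(p_2)$ for all paths $p_1,p_2$ with $o(p_1)=o(p_2)$ and $t(p_1)=t(p_2)$. A system of relations for $G$ is a finite set $\mathcal R=\{(s_1,s_1'),\dots,(s_n,s_n')\}$ of pairs of (not necessarily consecutive) edge sequences of $G$. It is complete if for every monoid $M$ and every labeling $l:E\to M$, the diagram $(G,l)$ is commutative if and only if $l(s_i)=l(s_i')$ for all $i$. The commutativity rank is $\eta(G)=\min_{\mathcal R}|\mathcal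 R|$, the minimum over all complete systems of relations for $G$. *)

theory Defs
  imports
    Complex_Main
    "HOL-Library.Countable_Set"
    "HOL-Library.FuncSet"
    "HOL-Algebra.Group"
    "Graph_Theory.Digraph"
    "Graph_Theory.Arc_Walk"
begin

text \<open>
  Graphs are the directed multigraphs of \<open>Graph_Theory\<close> (loops and parallel arcs allowed). In that
  library \<open>tail G e\<close> is the starting point of \<open>e\<close> (the origin \<open>o(e)\<close>) and \<open>head G e\<close> is its end
  point (written \<open>t(e)\<close> and called the tail in the source).  The paths \<open>p\<close> with \<open>o(p) = u\<close> and
  \<open>t(p) = v\<close> are exactly the arc lists with \<open>pre_digraph.awalk G u p v\<close>, including
  the empty one at every vertex.
\<close>

definition oriented_graph :: "('v, 'e) pre_digraph \<Rightarrow> bool" where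
  "oriented_graph G \<longleftrightarrow> fin_digraph G \<and> verts G \<noteq> {} \<and> arcs G \<noteq> {}"

definition label_prod :: "('m, 'c) monoid_scheme \<Rightarrow> ('e \<Rightarrow> 'm) \<Rightarrow> 'e list \<Rightarrow> 'm" where
  "label_prod M l s = foldr (\<lambda>e x. l e \<otimes>\<^bsub>M\<^esub> x) s \<one>\<^bsub>M\<^esub>"

definition commutative_diagram ::
    "('m, 'c) monoid_scheme \<Rightarrow> ('v, 'e) pre_digraph \<Rightarrow> ('e \<Rightarrow> 'm) \<Rightarrow> bool" where
  "commutative_diagram M G l \<longleftrightarrow>
     (\<forall>u v p q. pre_digraph.awalk G u p v \<longrightarrow> pre_digraph.awalk G u q v \<longrightarrow>
        label_prod M l p = label_prod M l q)"

definition satisfies_relations ::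
    "('m, 'c) monoid_scheme \<Rightarrow> ('e \<Rightarrow> 'm) \<Rightarrow> ('e list \<times> 'e list) set \<Rightarrow> bool" where
  "satisfies_relations M l R \<longleftrightarrow> (\<forall>(s, s') \<in> R. label_prod M l s = label_prod M l s')"

definition system_of_relations ::
    "('v, 'e) pre_digraph \<Rightarrow> ('e list \<times> 'e list) set \<Rightarrow> bool" where
  "system_of_relations G R \<longleftrightarrow> finite R \<and> R \<subseteq> lists (arcs G) \<times> lists (arcs G)"

text \<open>
  HOL cannot quantify over types inside a definition, so the monoids below are those whose carrier
  is a set of natural numbers.  Nothing is lost: the labels generate a countable submonoid, and
  the lemma \<open>complete_system_any_monoid\<close> transfers completeness to monoids over arbitrary types.
\<close>

definition complete_system ::
    "('v, 'e) pre_digraph \<Rightarrow> ('e list \<times> 'e list) set \<Rightarrow> bool" where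
  "complete_system G R \<longleftrightarrow> system_of_relations G R \<and>
     (\<forall>(M :: nat monoid) l. monoid M \<longrightarrow> l \<in> arcs G \<rightarrow> carrier M \<longrightarrow>
        (commutative_diagram M G l \<longleftrightarrow> satisfies_relations M l R))"

text \<open>
  The minimum is over a nonempty set whenever \<open>G\<close> is an oriented graph, see
  \<open>commutativity_rank_attained\<close>.
\<close>

definition commutativity_rank :: "('v, 'e) pre_digraph \<Rightarrow> nat" where
  "commutativity_rank G = (LEAST k. \<exists>R. complete_system G R \<and> card R = k)"


lemma label_prod_simps [simp]:
  "label_prod M l [] = \<one>\<^bsub>M\<^esub>"
  "label_prod M l (e # s) = l e \<otimes>\<^bsub>M\<^esub> label_prod M l s"
  by (simp_all add: label_prod_def)

lemma label_prod_closed: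
  assumes "monoid M" "l \<in> A \<rightarrow> carrier M" "s \<in> lists A"
  shows "label_prod M l s \<in> carrier M"
  using assms(3)
proof (induction s)
  case Nil
  then show ?case using assms(1) by (simp add: monoid.one_closed)
next
  case (Cons e s)
  then show ?case using assms(1,2) by (auto intro!: monoid.m_closed)
qed

lemma label_prod_append:
  assumes "monoid M" "l \<in> A \<rightarrow> carrier M" "s \<in> lists A" "s' \<in> lists A"
  shows "label_prod M l (s @ s') = label_prod M l s \<otimes>\<^bsub>M\<^esub> label_prod M l s'"
  using assms(3)
proof (induction s)
  case Nil
  show ?case
    using monoid.l_one[OF assms(1) label_prod_closed[OF assms(1,2,4)]] by simp
next
  case (Cons e s)
  have "l e \<in> carrier M" using Cons.hyps assms(2) by auto
  then have "l e \<otimes>\<^bsub>M\<^esub> label_prod M l s \<otimes>\<^bsub>M\<^esub> label_prod M l s' =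
      l e \<otimes>\<^bsub>M\<^esub> (label_prod M l s \<otimes>\<^bsub>M\<^esub> label_prod M l s')"
    using label_prod_closed[OF assms(1,2)] Cons.hyps assms(4)
    by (intro monoid.m_assoc[OF assms(1)]) auto
  then show ?case using Cons.IH by (simp only: append_Cons label_prod_simps)
qed

lemma complete_system_any_monoid:
  fixes M :: "('m, 'c) monoid_scheme"
  assumes fin: "finite (arcs G)" and R: "complete_system G R"
    and M: "monoid M" and l: "l \<in> arcs G \<rightarrow> carrier M"
  shows "commutative_diagram M G l \<longleftrightarrow> satisfies_relations M l R"
proof -
  define T where "T = label_prod M l ` lists (arcs G)"
  define f where "f = to_nat_on T"
  define g where "g = from_nat_into T"
  define N :: "nat monoid" where
    "N = \<lparr>carrier = f ` T, mult = (\<lambda>x y. f (g x \<otimes>\<^bsub>M\<^esub> g y)), one = f \<one>\<^bsub>M\<^esub>\<rparr>"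
  have "countable (lists (arcs G))"
    using fin by (simp add: countable_lists countable_finite)
  then have cT: "countable T" unfolding T_def by (rule countable_image)
  have gf: "g (f x) = x" if "x \<in> T" for x
    unfolding f_def g_def using cT that by (rule from_nat_into_to_nat_on)
  have TM: "T \<subseteq> carrier M"
    unfolding T_def using label_prod_closed[OF M l] by blast
  have T1: "\<one>\<^bsub>M\<^esub> \<in> T"
    unfolding T_def by (rule image_eqI[of _ _ "[]"]) auto
  have Tm: "x \<otimes>\<^bsub>M\<^esub> y \<in> T" if xy: "x \<in> T" "y \<in> T" for x y
  proof -
    obtain s s' where s: "s \<in> lists (arcs G)" "s' \<in> lists (arcs G)"
        "x = label_prod M l s" "y = label_prod M l s'"
      using xy unfolding T_def by blast
    then have "x \<otimes>\<^bsub>M\<^esub> y = label_prod M l (s @ s')"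
      by (simp only: label_prod_append[OF M l s(1,2)])
    moreover have "s @ s' \<in> lists (arcs G)" using s by simp
    ultimately show ?thesis unfolding T_def by (rule image_eqI)
  qed
  have N: "monoid N"
  proof (rule monoidI)
    show "\<one>\<^bsub>N\<^esub> \<in> carrier N" using T1 by (simp add: N_def)
  next
    fix x y assume "x \<in> carrier N" "y \<in> carrier N"
    then obtain a b where ab: "a \<in> T" "b \<in> T" "x = f a" "y = f b"
      unfolding N_def by auto
    then show "x \<otimes>\<^bsub>N\<^esub> y \<in> carrier N" by (simp add: N_def gf Tm)
  next
    fix x assume "x \<in> carrier N"
    then obtain a where a: "a \<in> T" "x = f a"
      unfolding N_def by auto
    then have "a \<in> carrier M" using TM by auto
    then have "\<one>\<^bsub>M\<^esub> \<otimes>\<^bsub>M\<^esub> a = a" "a \<otimes>\<^bsub>M\<^esub> \<one>\<^bsub>M\<^esub> = a"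
      by (simp_all add: monoid.l_one[OF M] monoid.r_one[OF M])
    then show "\<one>\<^bsub>N\<^esub> \<otimes>\<^bsub>N\<^esub> x = x" "x \<otimes>\<^bsub>N\<^esub> \<one>\<^bsub>N\<^esub> = x"
      using a T1 by (simp_all add: N_def gf)
  next
    fix x y z assume "x \<in> carrier N" "y \<in> carrier N" "z \<in> carrier N"
    then obtain a b c where abc: "a \<in> T" "b \<in> T" "c \<in> T" "x = f a" "y = f b" "z = f c"
      unfolding N_def by auto
    then have "a \<in> carrier M" "b \<in> carrier M" "c \<in> carrier M" using TM by auto
    then show "x \<otimes>\<^bsub>N\<^esub> y \<otimes>\<^bsub>N\<^esub> z = x \<otimes>\<^bsub>N\<^esub> (y \<otimes>\<^bsub>N\<^esub> z)"
      using abc by (simp add: N_def gf Tm monoid.m_assoc[OF M])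
  qed
  have lT: "l e \<in> T" if e: "e \<in> arcs G" for e
  proof -
    have "l e \<in> carrier M" using l e by auto
    then have "label_prod M l [e] = l e" by (simp add: monoid.r_one[OF M])
    moreover have "[e] \<in> lists (arcs G)" using e by simp
    ultimately show ?thesis unfolding T_def by (intro image_eqI[of _ _ "[e]"]) simp_all
  qed
  have lN: "f \<circ> l \<in> arcs G \<rightarrow> carrier N"
    using lT by (auto simp: N_def)
  have prod: "label_prod N (f \<circ> l) s = f (label_prod M l s)" if "s \<in> lists (arcs G)" for s
    using that
  proof (induction s)
    case (Cons e s)
    then have "l e \<in> T" "label_prod M l s \<in> T" using lT by (auto simp: T_def)
    with Cons show ?case by (simp add: N_def gf)
  qed (simp add: N_def)
  have eq: "label_prod N (f \<circ> l) s = label_prod N (f \<circ> l) s' \<longleftrightarrow>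
      label_prod M l s = label_prod M l s'"
    if "s \<in> lists (arcs G)" "s' \<in> lists (arcs G)" for s s'
  proof -
    have "label_prod M l s \<in> T" "label_prod M l s' \<in> T"
      unfolding T_def using that by (blast intro: imageI)+
    then have "f (label_prod M l s) = f (label_prod M l s') \<longleftrightarrow> label_prod M l s = label_prod M l s'"
      using gf by metis
    then show ?thesis by (simp only: prod[OF that(1)] prod[OF that(2)])
  qed
  have "p \<in> lists (arcs G)" if "pre_digraph.awalk G u p v" for u p v
    using that by (auto simp: pre_digraph.awalk_def)
  then have "commutative_diagram N G (f \<circ> l) \<longleftrightarrow> commutative_diagram M G l"
    unfolding commutative_diagram_def using eq by blast
  moreover have "satisfies_relations N (f \<circ> l) R \<longleftrightarrow> satisfies_relations M l R"
  proof -
    have "R \<subseteq> lists (arcs G) \<times> lists (arcs G)"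
      using R unfolding complete_system_def system_of_relations_def by blast
    then show ?thesis unfolding satisfies_relations_def using eq by blast
  qed
  moreover have "commutative_diagram N G (f \<circ> l) \<longleftrightarrow> satisfies_relations N (f \<circ> l) R"
    using R N lN unfolding complete_system_def by blast
  ultimately show ?thesis by blast
qed

lemma complete_system_exists:
  assumes "oriented_graph G"
  shows "\<exists>R. complete_system G R"
proof -
  interpret fin_digraph G using assms by (simp add: oriented_graph_def)
  define B where "B = {p. set p \<subseteq> arcs G \<and> length p \<le> Suc (card (verts G))}"
  define R where "R = {(p, q) \<in> B \<times> B. \<exists>u v. awalk u p v \<and> awalk u q v}"
  have "finite B" unfolding B_def by (rule finite_lists_length_le) simp
  then have "finite R" unfolding R_def
    by (rule_tac finite_subset[of _ "B \<times> B"]) auto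
  moreover have "R \<subseteq> lists (arcs G) \<times> lists (arcs G)" by (auto simp: R_def B_def)
  moreover have "commutative_diagram M G l \<longleftrightarrow> satisfies_relations M l R"
    for M :: "nat monoid" and l
  proof
    assume "commutative_diagram M G l"
    then show "satisfies_relations M l R"
      unfolding commutative_diagram_def satisfies_relations_def R_def by blast
  next
    assume sat: "satisfies_relations M l R"
    have rel: "label_prod M l p = label_prod M l q"
      if "awalk u p v" "awalk u q v"
        "length p \<le> Suc (card (verts G))" "length q \<le> Suc (card (verts G))" for u v p q
    proof -
      have "(p, q) \<in> R" using that by (auto simp: R_def B_def awalk_def)
      then show ?thesis using sat unfolding satisfies_relations_def by blast
    qed
    have short: "\<exists>q. awalk u q v \<and> length q \<le> card (verts G) \<and> label_prod M l q = label_prod M l p"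
      if "awalk u p v" for u p v
      using that
    proof (induction p arbitrary: u)
      case Nil
      then show ?case by auto
    next
      case (Cons e p)
      then have e: "e \<in> arcs G" "tail G e = u" "awalk (head G e) p v"
        by (auto simp: awalk_Cons_iff)
      then obtain q where q: "awalk (head G e) q v" "length q \<le> card (verts G)"
          "label_prod M l q = label_prod M l p"
        using Cons.IH by blast
      have w: "awalk u (e # q) v" using e q by (auto simp: awalk_Cons_iff)
      then have a: "apath u (awalk_to_apath (e # q)) v" by (rule apath_awalk_to_apath)
      then have len: "length (awalk_to_apath (e # q)) \<le> card (verts G)" by (rule length_apath)
      have "awalk u (awalk_to_apath (e # q)) v" using a by (simp add: apath_def)
      moreover from this have "label_prod M l (awalk_to_apath (e # q)) = label_prod M l (e # q)"
        using w len q(2) by (intro rel) auto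
      ultimately show ?case using len q(3) by auto
    qed
    show "commutative_diagram M G l"
      unfolding commutative_diagram_def
    proof (intro allI impI)
      fix u v p q assume "awalk u p v" "awalk u q v"
      then show "label_prod M l p = label_prod M l q"
        using short[of u p v] short[of u q v] rel by (metis le_SucI)
    qed
  qed
  ultimately have "complete_system G R"
    unfolding complete_system_def system_of_relations_def by simp
  then show ?thesis by (rule exI)
qed

lemma commutativity_rank_attained:
  assumes "oriented_graph G"
  shows "\<exists>R. complete_system G R \<and> card R = commutativity_rank G"
  unfolding commutativity_rank_def using complete_system_exists[OF assms]
  by (rule_tac LeastI_ex) blast

lemma commutativity_rank_le:
  "complete_system G R \<Longrightarrow> commutativity_rank G \<le> card R"
  unfolding commutativity_rank_def by (rule Least_le) blast

end

theory Submission
  imports Defs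
begin

text \<open>
  Two independent lower bounds on the commutativity rank are combined.

  The first bound counts loops.  In a commutative diagram every loop has label \<open>\<one>\<close>.  Labelings
  of the loops in the group of order two are vectors over the field with two elements, and each
  relation is one linear equation on them; fewer equations than loops leave a nonzero solution,
  which is a noncommutative diagram satisfying all relations.  So the rank is at least the number
  of loops (\<open>loops_le_commutativity_rank\<close>).

  The second bound counts paths of length two.  Label the edges by letters, and kill every word
  of length at least two; for a graph in which two parallel paths have the same length and in
  which there are no parallel edges, this diagram is commutative.  Now revive a single word \<open>w\<close>
  that is a path of length two parallel to some other path.  Commutativity is lost, so some
  relation has to notice it, but the two monoids differ only in the value of \<open>w\<close>, so one side of
  that relation is \<open>w\<close> itself.  A relation has only two sides, hence the number of such paths
  is at most twice the rank (\<open>parallel_two_paths_le_commutativity_rank\<close>).  Loops, labelled \<open>\<one>\<close>,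
  do no harm, so they can be used to adjust the number of edges.

  The graph for the theorem has three layers of sizes \<open>a\<close>, \<open>b\<close>, \<open>a\<close>, all edges from
  each layer to the next, and loops for the remaining edges.  It has \<open>a * a * b\<close> paths of length
  two.  Let \<open>N = min n m\<close>, \<open>Y = min (n\<^sup>2) m\<close>.  Taking \<open>a\<close> of order \<open>N\<close> and \<open>b\<close> of order \<open>Y / N\<close>
  makes \<open>a * a * b\<close> of order \<open>Y * N\<close>, with \<open>a * b\<close> of order at most \<open>m\<close> edges.  This is enough
  if \<open>Y * N\<close> is large compared to \<open>m\<close>; otherwise \<open>m\<close> loops suffice.
\<close>

section \<open>Counting loops\<close>

definition xor_group :: "bool monoid" where
  "xor_group = \<lparr>carrier = UNIV, mult = (\<noteq>), one = False\<rparr>"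

lemma monoid_xor_group: "monoid xor_group"
  by (rule monoidI) (auto simp: xor_group_def)

lemma label_prod_xor_group_diff:
  "label_prod xor_group (\<lambda>e. l e \<noteq> l' e) s \<longleftrightarrow>
     label_prod xor_group l s \<noteq> label_prod xor_group l' s"
  by (induction s) (auto simp: xor_group_def)

lemma loops_le_commutativity_rank:
  assumes G: "oriented_graph G"
  shows "card {e \<in> arcs G. tail G e = head G e} \<le> commutativity_rank G"
proof (rule ccontr)
  define L where "L = {e \<in> arcs G. tail G e = head G e}"
  assume "\<not> ?thesis"
  then have less: "commutativity_rank G < card L" by (simp add: L_def)
  interpret fin_digraph G using G by (simp add: oriented_graph_def)
  obtain R where R: "complete_system G R" "card R = commutativity_rank G"
    using commutativity_rank_attained[OF G] by blast
  have finR: "finite R" using R(1) by (simp add: complete_system_def system_of_relations_def)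
  have finL: "finite L" by (simp add: L_def)
  \<comment> \<open>A set \<open>S\<close> of loops is a labeling, and the violated relations are its image under the
    linear map given by the relations; pigeonhole replaces a dimension count.\<close>
  define viol where "viol S = {(s, s') \<in> R. label_prod xor_group (\<lambda>e. e \<in> S) s \<noteq>
    label_prod xor_group (\<lambda>e. e \<in> S) s'}" for S
  have "viol ` Pow L \<subseteq> Pow R" by (auto simp: viol_def)
  moreover have "card (Pow R) < card (Pow L)"
    using less R(2) finR finL by (simp add: card_Pow)
  ultimately have "\<not> inj_on viol (Pow L)"
    using card_inj_on_le[of viol "Pow L" "Pow R"] finR by auto
  then obtain S T where ST: "S \<subseteq> L" "T \<subseteq> L" "S \<noteq> T" "viol S = viol T"
    by (auto simp: inj_on_def)
  define l where "l e \<longleftrightarrow> (e \<in> S) \<noteq> (e \<in> T)" for e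
  have l_prod: "label_prod xor_group l s \<longleftrightarrow> label_prod xor_group (\<lambda>e. e \<in> S) s \<noteq>
      label_prod xor_group (\<lambda>e. e \<in> T) s" for s
    unfolding l_def by (rule label_prod_xor_group_diff)
  have "satisfies_relations xor_group l R"
    unfolding satisfies_relations_def
  proof (clarify)
    fix s s' assume "(s, s') \<in> R"
    moreover have "(s, s') \<in> viol S \<longleftrightarrow> (s, s') \<in> viol T" using ST(4) by simp
    ultimately show "label_prod xor_group l s \<longleftrightarrow> label_prod xor_group l s'"
      unfolding l_prod viol_def by auto
  qed
  moreover have "l \<in> arcs G \<rightarrow> carrier xor_group" by (simp add: xor_group_def)
  ultimately have comm: "commutative_diagram xor_group G l"
    using complete_system_any_monoid[OF finite_arcs R(1) monoid_xor_group] by blast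
  obtain e where e: "l e" "e \<in> L" using ST(1-3) by (auto simp: l_def)
  then have "awalk (tail G e) [e] (tail G e)" "awalk (tail G e) [] (tail G e)"
    by (auto simp: L_def awalk_Cons_iff awalk_Nil_iff)
  then have "label_prod xor_group l [e] = label_prod xor_group l []"
    using comm unfolding commutative_diagram_def by blast
  then show False using e(1) by (simp add: xor_group_def)
qed

section \<open>Counting paths of length two\<close>

text \<open>
  The Rees quotient of the free monoid by the words outside \<open>F\<close>; these form an ideal when \<open>F\<close>
  is closed under factors, and \<open>None\<close> is the resulting zero.
\<close>

definition word_monoid :: "'e list set \<Rightarrow> 'e list option monoid" where
  "word_monoid F = \<lparr>carrier = insert None (Some ` F),
     mult = (\<lambda>x y. case (x, y) of (Some u, Some v) \<Rightarrow> if u @ v \<in> F then Some (u @ v) else None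
                     | _ \<Rightarrow> None),
     one = Some []\<rparr>"

definition factor_closed :: "'e list set \<Rightarrow> bool" where
  "factor_closed F \<longleftrightarrow> [] \<in> F \<and> (\<forall>u v. u @ v \<in> F \<longrightarrow> u \<in> F \<and> v \<in> F)"

lemma factor_closed_Nil: "factor_closed F \<Longrightarrow> [] \<in> F"
  unfolding factor_closed_def by blast

lemma word_monoid_mult:
  "Some u \<otimes>\<^bsub>word_monoid F\<^esub> Some v = (if u @ v \<in> F then Some (u @ v) else None)"
  "None \<otimes>\<^bsub>word_monoid F\<^esub> y = None"
  "x \<otimes>\<^bsub>word_monoid F\<^esub> None = None"
  by (auto simp: word_monoid_def split: option.splits)

lemma monoid_word_monoid:
  fixes F :: "'e list set"
  assumes "factor_closed F"
  shows "monoid (word_monoid F)"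
proof -
  have Nil: "[] \<in> F" using assms by (rule factor_closed_Nil)
  show ?thesis
  proof (rule monoidI)
    fix x y z :: "'e list option"
    show "x \<otimes>\<^bsub>word_monoid F\<^esub> y \<otimes>\<^bsub>word_monoid F\<^esub> z =
        x \<otimes>\<^bsub>word_monoid F\<^esub> (y \<otimes>\<^bsub>word_monoid F\<^esub> z)"
    proof (cases "x = None \<or> y = None \<or> z = None")
      case True
      then show ?thesis by (auto simp: word_monoid_mult)
    next
      case False
      then obtain u v w where xyz: "x = Some u" "y = Some v" "z = Some w" by auto
      have "u @ v \<in> F" "v @ w \<in> F" if "u @ v @ w \<in> F"
        using assms that append_assoc[of u v w] unfolding factor_closed_def by metis+
      then show ?thesis unfolding xyz by (auto simp: word_monoid_mult)
    qed
  qed (use Nil in \<open>auto simp: word_monoid_def split: option.splits\<close>)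
qed

definition letter_label :: "('v, 'e) pre_digraph \<Rightarrow> 'e \<Rightarrow> 'e list option" where
  "letter_label G e = Some (if tail G e = head G e then [] else [e])"

definition loopless :: "('v, 'e) pre_digraph \<Rightarrow> 'e list \<Rightarrow> 'e list" where
  "loopless G s = filter (\<lambda>e. tail G e \<noteq> head G e) s"

lemma label_prod_word_monoid:
  assumes "factor_closed F"
  shows "label_prod (word_monoid F) (letter_label G) s =
    (if loopless G s \<in> F then Some (loopless G s) else None)"
proof (induction s)
  case Nil
  then show ?case using factor_closed_Nil[OF assms] by (simp add: word_monoid_def loopless_def)
next
  case (Cons e s)
  have "loopless G s \<in> F" if "e # loopless G s \<in> F"
    using assms that append_Cons[of e "[]"] unfolding factor_closed_def by (metis append_Nil)
  with Cons show ?case by (auto simp: word_monoid_def letter_label_def loopless_def)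
qed

lemma (in wf_digraph) awalk_loopless:
  assumes "awalk u p v"
  shows "awalk u (loopless G p) v"
  using assms
  by (induction p arbitrary: u) (auto simp: loopless_def awalk_Cons_iff)

lemma (in wf_digraph) graded_awalk_length:
  fixes h :: "'a \<Rightarrow> nat"
  assumes "\<And>e. e \<in> arcs G \<Longrightarrow> tail G e \<noteq> head G e \<Longrightarrow> h (head G e) = Suc (h (tail G e))"
    and "awalk u p v"
  shows "h v = h u + length (loopless G p)"
  using assms(2)
proof (induction p arbitrary: u)
  case (Cons e p)
  then have "e \<in> arcs G" "tail G e = u" "awalk (head G e) p v"
    by (auto simp: awalk_Cons_iff)
  with Cons.IH[of "head G e"] assms(1)[of e] show ?case by (auto simp: loopless_def)
qed (auto simp: loopless_def awalk_Nil_iff)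

text \<open>
  A function \<open>h\<close> that increases by one along every non-loop forces parallel paths to have the same
  length once loops are removed.  If this length is one, the two paths agree since there are no
  parallel edges; so parallel paths that differ have length at least two, and killing all words
  of such length gives a commutative diagram.
\<close>

lemma parallel_two_paths_le_commutativity_rank:
  fixes G :: "('v, 'e) pre_digraph" and h :: "'v \<Rightarrow> nat"
  assumes G: "oriented_graph G"
    and graded: "\<And>e. e \<in> arcs G \<Longrightarrow> tail G e \<noteq> head G e \<Longrightarrow> h (head G e) = Suc (h (tail G e))"
    and simple: "\<And>e f. e \<in> arcs G \<Longrightarrow> f \<in> arcs G \<Longrightarrow> tail G e \<noteq> head G e \<Longrightarrow>
      tail G e = tail G f \<Longrightarrow> head G e = head G f \<Longrightarrow> e = f"
    and W: "\<And>w. w \<in> W \<Longrightarrow> length w = 2 \<and> loopless G w = w \<and>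
      (\<exists>u v w'. pre_digraph.awalk G u w v \<and> pre_digraph.awalk G u w' v \<and> loopless G w' \<noteq> w)"
  shows "card W \<le> 2 * commutativity_rank G"
proof -
  interpret fin_digraph G using G by (simp add: oriented_graph_def)
  obtain R where R: "complete_system G R" "card R = commutativity_rank G"
    using commutativity_rank_attained[OF G] by blast
  have finR: "finite R" using R(1) by (simp add: complete_system_def system_of_relations_def)
  define F0 :: "'e list set" where "F0 = {u. length u \<le> 1}"
  have F0: "factor_closed F0" by (auto simp: factor_closed_def F0_def)
  have lab: "letter_label G \<in> arcs G \<rightarrow> carrier (word_monoid F)" if "F0 \<subseteq> F" for F
  proof -
    have "(if tail G e = head G e then [] else [e]) \<in> F" for e
      using that by (auto simp: F0_def subset_iff)
    then show ?thesis by (auto simp: letter_label_def word_monoid_def intro!: imageI simp del: if_split)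
  qed
  have "loopless G p = loopless G q \<or> loopless G p \<notin> F0 \<and> loopless G q \<notin> F0"
    if "awalk u p v" "awalk u q v" for u v p q
  proof -
    let ?p = "loopless G p" and ?q = "loopless G q"
    have pq: "awalk u ?p v" "awalk u ?q v" using that by (simp_all add: awalk_loopless)
    have len: "length ?p = length ?q"
      using graded_awalk_length[of h u p v, OF graded] graded_awalk_length[of h u q v, OF graded]
        that by simp
    consider "length ?p = 0" | "length ?p = 1" | "length ?p \<ge> 2" by linarith
    then show ?thesis
    proof cases
      case 2
      then obtain e f where ef: "?p = [e]" "?q = [f]"
        using len by (metis One_nat_def length_0_conv length_Suc_conv)
      have "e \<in> set ?p" using ef(1) by simp
      then have "tail G e \<noteq> head G e" by (simp add: loopless_def)
      with pq ef have "e = f" by (intro simple) (auto simp: awalk_Cons_iff awalk_Nil_iff)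
      then show ?thesis using ef by simp
    qed (use len in \<open>auto simp: F0_def\<close>)
  qed
  then have "commutative_diagram (word_monoid F0) G (letter_label G)"
    unfolding commutative_diagram_def label_prod_word_monoid[OF F0] by (metis (full_types))
  then have sat0: "satisfies_relations (word_monoid F0) (letter_label G) R"
    using complete_system_any_monoid[OF finite_arcs R(1) monoid_word_monoid[OF F0] lab[OF order_refl]]
    by simp
  have "W \<subseteq> (\<lambda>(s, s'). loopless G s) ` R \<union> (\<lambda>(s, s'). loopless G s') ` R" (is "_ \<subseteq> ?S \<union> ?T")
  proof
    fix w assume "w \<in> W"
    then obtain u v w' where w: "length w = 2" "loopless G w = w" "awalk u w v" "awalk u w' v"
        "loopless G w' \<noteq> w"
      using W by blast
    let ?F = "insert w F0"
    have F: "factor_closed ?F"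
      unfolding factor_closed_def
    proof (intro conjI allI impI)
      fix x y assume xy: "x @ y \<in> insert w F0"
      show "x \<in> insert w F0" "y \<in> insert w F0"
        using xy w(1) by (cases x; cases y; auto simp: F0_def)+
    qed (simp add: F0_def)
    have "label_prod (word_monoid ?F) (letter_label G) w \<noteq>
        label_prod (word_monoid ?F) (letter_label G) w'"
      unfolding label_prod_word_monoid[OF F] using w(2,5) by auto
    then have "\<not> commutative_diagram (word_monoid ?F) G (letter_label G)"
      unfolding commutative_diagram_def using w(3,4) by blast
    then have "\<not> satisfies_relations (word_monoid ?F) (letter_label G) R"
      using complete_system_any_monoid[OF finite_arcs R(1) monoid_word_monoid[OF F] lab] by blast
    then obtain s s' where s: "(s, s') \<in> R"
        "label_prod (word_monoid ?F) (letter_label G) s \<noteq>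
         label_prod (word_monoid ?F) (letter_label G) s'"
      unfolding satisfies_relations_def by blast
    moreover have "label_prod (word_monoid F0) (letter_label G) s =
        label_prod (word_monoid F0) (letter_label G) s'"
      using sat0 s(1) unfolding satisfies_relations_def by blast
    ultimately have "loopless G s = w \<or> loopless G s' = w"
      unfolding label_prod_word_monoid[OF F] label_prod_word_monoid[OF F0]
      by (auto split: if_splits)
    then show "w \<in> ?S \<union> ?T" using s(1) by force
  qed
  then have "card W \<le> card (?S \<union> ?T)" using finR by (intro card_mono) auto
  also have "\<dots> \<le> card ?S + card ?T" by (rule card_Un_le)
  also have "\<dots> \<le> card R + card R" by (intro add_mono card_image_le finR)
  finally show ?thesis using R(2) by simp
qed

section \<open>Three complete layers with additional loops\<close>

text \<open>
  The layers are \<open>{..<a}\<close>, \<open>{a..<a + b}\<close> and \<open>{a + b..<a + b + a}\<close>.  The edge from the first-layer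
  vertex \<open>i\<close> to the middle vertex \<open>j\<close> (counted within its layer) is \<open>i * b + j\<close>, and the edge
  from there to the third-layer vertex \<open>k\<close> is \<open>a * b + (k * b + j)\<close>.  All edges from
  \<open>2 * (a * b)\<close> on are loops at the vertex \<open>0\<close>, so \<open>a = 0\<close> gives a bouquet of \<open>m\<close> loops.
\<close>

definition layered_graph :: "nat \<Rightarrow> nat \<Rightarrow> nat \<Rightarrow> nat \<Rightarrow> (nat, nat) pre_digraph" where
  "layered_graph a b n m = \<lparr>verts = {..<n}, arcs = {..<m},
     tail = (\<lambda>e. if e < a * b then e div b
                 else if e < 2 * (a * b) then a + (e - a * b) mod b else 0),
     head = (\<lambda>e. if e < a * b then a + e mod b
                 else if e < 2 * (a * b) then a + b + (e - a * b) div b else 0)\<rparr>"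

lemma layered_arc_cases:
  fixes e a b :: nat
  obtains (first) i j where "i < a" "j < b" "e = i * b + j"
    | (second) k j where "k < a" "j < b" "e = a * b + (k * b + j)"
    | (loop) "2 * (a * b) \<le> e"
proof -
  have dm: "x div b < a \<and> x mod b < b \<and> x = x div b * b + x mod b" if "x < a * b" for x
  proof -
    have "b > 0" using that by (cases b) auto
    then show ?thesis using that by (simp add: less_mult_imp_div_less)
  qed
  consider "e < a * b" | "a * b \<le> e" "e - a * b < a * b" | "2 * (a * b) \<le> e" by linarith
  then show thesis
  proof cases
    case 1
    then show thesis using first dm by blast
  next
    case 2
    then show thesis using second[of "(e - a * b) div b" "(e - a * b) mod b"] dm[of "e - a * b"]
      by simp
  next
    case 3
    then show thesis by (rule loop)
  qed
qed

lemma index_less: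
  fixes i j a b :: nat
  assumes "i < a" "j < b"
  shows "i * b + j < a * b"
proof -
  have "i * b + j < Suc i * b" using assms(2) by simp
  also have "\<dots> \<le> a * b" using assms(1) by (intro mult_right_mono) simp_all
  finally show ?thesis .
qed

lemma layered_graph_simps:
  "verts (layered_graph a b n m) = {..<n}"
  "arcs (layered_graph a b n m) = {..<m}"
  "i < a \<Longrightarrow> j < b \<Longrightarrow> tail (layered_graph a b n m) (i * b + j) = i"
  "i < a \<Longrightarrow> j < b \<Longrightarrow> head (layered_graph a b n m) (i * b + j) = a + j"
  "i < a \<Longrightarrow> j < b \<Longrightarrow> tail (layered_graph a b n m) (a * b + (i * b + j)) = a + j"
  "i < a \<Longrightarrow> j < b \<Longrightarrow> head (layered_graph a b n m) (a * b + (i * b + j)) = a + b + i"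
  "2 * (a * b) \<le> e \<Longrightarrow> tail (layered_graph a b n m) e = 0"
  "2 * (a * b) \<le> e \<Longrightarrow> head (layered_graph a b n m) e = 0"
  using index_less[of i a j b] by (auto simp: layered_graph_def)

lemma oriented_layered_graph:
  assumes "2 * a + b \<le> n" "0 < n" "0 < m"
  shows "oriented_graph (layered_graph a b n m)"
proof -
  have ends: "tail (layered_graph a b n m) e < n \<and> head (layered_graph a b n m) e < n" for e
    using assms by (cases e rule: layered_arc_cases[of a b]) (auto simp: layered_graph_simps)
  have "fin_digraph (layered_graph a b n m)"
    by unfold_locales (use ends in \<open>auto simp: layered_graph_simps(1,2)\<close>)
  then show ?thesis using assms by (auto simp: oriented_graph_def layered_graph_simps(1,2))
qed

lemma bouquet_rank:
  assumes "0 < n" "b \<le> n" "0 < m"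
  shows "m \<le> commutativity_rank (layered_graph 0 b n m)"
proof -
  let ?G = "layered_graph 0 b n m"
  have "oriented_graph ?G" using assms by (intro oriented_layered_graph) simp_all
  from loops_le_commutativity_rank[OF this] show ?thesis by (simp add: layered_graph_def)
qed

lemma layered_graph_rank:
  assumes size: "2 * a + b \<le> n" "2 * (a * b) \<le> m" "0 < a" and b: "2 \<le> b"
  shows "a * a * b \<le> 2 * commutativity_rank (layered_graph a b n m)"
proof -
  let ?G = "layered_graph a b n m"
  define h :: "nat \<Rightarrow> nat" where "h v = (if v < a then 0 else if v < a + b then 1 else 2)" for v
  define path where "path = (\<lambda>(i, k, j). [i * b + j, a * b + (k * b + j)])"
  define I where "I = {..<a} \<times> {..<a} \<times> {..<b}"
  have pos: "0 < a * b" using size(3) b by simp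
  have "0 < m" using pos size(2) by linarith
  then have G: "oriented_graph ?G" using size by (intro oriented_layered_graph) auto
  interpret fin_digraph ?G using G by (simp add: oriented_graph_def)
  have walk: "awalk i (path (i, k, j)) (a + b + k)" "loopless ?G (path (i, k, j)) = path (i, k, j)"
    if "i < a" "k < a" "j < b" for i k j
    using that size index_less[of i a j b] index_less[of k a j b]
    by (auto simp: path_def awalk_Cons_iff awalk_Nil_iff layered_graph_simps loopless_def)
  have "card (path ` I) \<le> 2 * commutativity_rank ?G"
  proof (rule parallel_two_paths_le_commutativity_rank[where h = h, OF G])
    fix e assume "tail ?G e \<noteq> head ?G e"
    then show "h (head ?G e) = Suc (h (tail ?G e))"
      by (cases e rule: layered_arc_cases[of a b]) (auto simp: layered_graph_simps h_def)
  next
    fix e f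
    assume ef: "tail ?G e \<noteq> head ?G e" "tail ?G e = tail ?G f" "head ?G e = head ?G f"
    then have "\<not> 2 * (a * b) \<le> e" "\<not> 2 * (a * b) \<le> f" by (auto simp: layered_graph_simps)
    with ef show "e = f"
      by (cases e rule: layered_arc_cases[of a b]; cases f rule: layered_arc_cases[of a b])
        (auto simp: layered_graph_simps)
  next
    fix w assume "w \<in> path ` I"
    then obtain i k j where w: "w = path (i, k, j)" "i < a" "k < a" "j < b"
      by (auto simp: I_def)
    \<comment> \<open>A parallel path goes through any other vertex of the middle layer.\<close>
    obtain j' where j': "j' < b" "j' \<noteq> j"
      using b that[of 0] that[of 1] by (cases "j = 0") auto
    then have "path (i, k, j') \<noteq> w" by (simp add: path_def w(1))
    then show "length w = 2 \<and> loopless ?G w = w \<and>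
        (\<exists>u v w'. awalk u w v \<and> awalk u w' v \<and> loopless ?G w' \<noteq> w)"
      using walk[OF w(2-4)] walk[OF w(2,3) j'(1)] unfolding w(1)
      by (metis (no_types, lifting) One_nat_def Suc_1 length_Cons list.size(3) old.prod.case path_def)
  qed
  moreover have "inj_on path I"
  proof (rule inj_onI)
    fix x y assume "x \<in> I" "y \<in> I" and eq: "path x = path y"
    then obtain i k j i' k' j' where xy: "x = (i, k, j)" "y = (i', k', j')"
        "i < a" "k < a" "j < b" "i' < a" "k' < a" "j' < b"
      by (auto simp: I_def)
    have e1: "i * b + j = i' * b + j'" and e2: "k * b + j = k' * b + j'"
      using eq by (simp_all add: path_def xy(1,2))
    have "i = i'" "j = j'" "k = k'"
      using arg_cong[OF e1, of "\<lambda>x. x div b"] arg_cong[OF e1, of "\<lambda>x. x mod b"]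
        arg_cong[OF e2, of "\<lambda>x. x div b"] xy by auto
    then show "x = y" by (simp add: xy(1,2))
  qed
  ultimately show ?thesis by (simp add: card_image I_def)
qed

section \<open>Choice of the layer sizes\<close>

text \<open>
  The width \<open>a\<close> is \<open>N / 8\<close> and the middle layer has about \<open>Y / (16 * N)\<close> vertices: then
  \<open>2 * (a * b)\<close> is about \<open>Y / 64 \<le> m / 64\<close>, and \<open>b\<close> is at most about \<open>n / 16\<close> since
  \<open>Y \<le> n * N\<close>.  For \<open>m \<le> n\<close> the quotient vanishes, so two vertices are added to the middle
  layer; they keep every path parallel to another one, make up for rounding down, and cost only
  about \<open>N / 2\<close> edges.
\<close>

lemma layer_sizes_exist:
  fixes n m :: nat
  defines "N \<equiv> min n m" and "Y \<equiv> min (n\<^sup>2) m"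
  assumes N: "16 \<le> N"
  shows "\<exists>a b. 2 * a + b \<le> n \<and> 2 * (a * b) \<le> m \<and> 0 < a \<and> 2 \<le> b \<and> Y * N \<le> 2 ^ 12 * (a * a * b)"
proof (intro exI conjI)
  let ?a = "N div 8" and ?b = "2 + Y div (16 * N)"
  have bN: "Y div (16 * N) * (16 * N) \<le> Y" by (rule div_times_less_eq_dividend)
  have Y: "Y \<le> n * N"
  proof (cases "n \<le> m")
    case True
    then show ?thesis by (simp add: Y_def N_def power2_eq_square)
  next
    case False
    have "Y \<le> m" by (simp add: Y_def)
    also have "m \<le> n * m" using N by (simp add: N_def)
    finally show ?thesis using False by (simp add: N_def)
  qed
  have "Y div (16 * N) * 16 * N \<le> n * N" using order_trans[OF bN Y] by (simp only: mult.assoc)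
  then have "Y div (16 * N) * 16 \<le> n" using N by simp
  moreover have "N \<le> n" by (simp add: N_def)
  ultimately show "2 * ?a + ?b \<le> n" using N by linarith
  have "16 * (2 * (?a * ?b)) \<le> 4 * (8 * ?a) * ?b" by simp
  also have "\<dots> \<le> 4 * N * ?b" by (intro mult_right_mono) simp_all
  also have "\<dots> \<le> 8 * N + Y div (16 * N) * (16 * N)" by (simp add: algebra_simps)
  also have "\<dots> \<le> 8 * m + m"
    using bN by (intro add_mono) (auto simp: N_def Y_def)
  also have "\<dots> \<le> 16 * m" by simp
  finally show "2 * (?a * ?b) \<le> m" by simp
  show "0 < ?a" using N by simp
  have "N \<le> 16 * ?a" using N by linarith
  then have aa: "N * N \<le> (16 * ?a) * (16 * ?a)" by (intro mult_mono) simp_all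
  have "Y = Y div (16 * N) * (16 * N) + Y mod (16 * N)"
    by (rule div_mult_mod_eq[symmetric])
  moreover have "Y mod (16 * N) < 16 * N" using N by simp
  ultimately have "Y \<le> ?b * (16 * N)" by (simp add: algebra_simps)
  then have "Y * N \<le> ?b * (16 * N) * N" by (rule mult_right_mono) simp
  also have "\<dots> = 16 * ?b * (N * N)" by (simp add: algebra_simps)
  also have "\<dots> \<le> 16 * ?b * ((16 * ?a) * (16 * ?a))" using aa by (rule mult_left_mono) simp
  finally show "Y * N \<le> 2 ^ 12 * (?a * ?a * ?b)" by (simp add: algebra_simps)
qed simp

text \<open>
  With \<open>N = min n m\<close> and \<open>Y = min (n\<^sup>2) m\<close>, the bouquet handles all small cases, because
  \<open>Y * N\<close> is at most \<open>m * N\<close>.  Otherwise \<open>m \<le> Y * N\<close>, so the summand \<open>m\<close> costs a factor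
  two; the two sides of a relation cost another factor two, and the layer sizes cost \<open>2 ^ 12\<close>.
\<close>

lemma graph_with_large_rank:
  fixes n m :: nat
  assumes "0 < n" "0 < m"
  shows "\<exists>G :: (nat, nat) pre_digraph. oriented_graph G \<and> card (verts G) = n \<and> card (arcs G) = m \<and>
    min (n\<^sup>2) m * min n m + m \<le> 2 ^ 14 * commutativity_rank G"
proof -
  let ?N = "min n m" and ?Y = "min (n\<^sup>2) m"
  show ?thesis
  proof (cases "?Y * ?N + m \<le> 2 ^ 14 * m")
    case True
    let ?G = "layered_graph 0 0 n m"
    have "2 ^ 14 * m \<le> 2 ^ 14 * commutativity_rank ?G"
      using bouquet_rank[of n 0 m] assms by simp
    with True assms oriented_layered_graph[of 0 0 n m] show ?thesis
      by (intro exI[of _ ?G]) (auto simp: layered_graph_simps(1,2))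
  next
    case False
    have "16 \<le> ?N"
    proof (rule ccontr)
      assume "\<not> 16 \<le> ?N"
      then have "?N \<le> 16" by linarith
      then have "?Y * ?N \<le> m * 16" by (intro mult_mono min.cobounded2) simp_all
      with False show False by simp
    qed
    from layer_sizes_exist[OF this] obtain a b where
      ab: "2 * a + b \<le> n" "2 * (a * b) \<le> m" "0 < a" "2 \<le> b" "?Y * ?N \<le> 2 ^ 12 * (a * a * b)"
      by blast
    have "x + m \<le> 2 ^ 14 * r" if "x \<le> 2 ^ 12 * p" "p \<le> 2 * r" "m \<le> x" for x p r :: nat
      using that by simp
    moreover have "m \<le> ?Y * ?N" using False by simp
    ultimately have "?Y * ?N + m \<le> 2 ^ 14 * commutativity_rank (layered_graph a b n m)"
      using ab(5) layered_graph_rank[OF ab(1-4)] by blast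
    then show ?thesis using assms oriented_layered_graph[of a b n m] ab(1)
      by (intro exI[of _ "layered_graph a b n m"]) (auto simp: layered_graph_simps(1,2))
  qed
qed

theorem theorem2p9:
  shows "\<exists>C :: real. C > 0 \<and> C = 1 / 2 ^ 14 \<and>
    (\<forall>n m :: nat. n \<ge> 4 \<longrightarrow> m \<ge> 4 \<longrightarrow>
      (\<exists>G :: (nat, nat) pre_digraph.
         oriented_graph G \<and> card (verts G) = n \<and> card (arcs G) = m \<and>
         real (commutativity_rank G) \<ge>
           C * (min (real (card (verts G)) ^ 2) (real (card (arcs G)))
                  * min (real (card (verts G))) (real (card (arcs G)))
                + real (card (arcs G)))))"
proof (intro exI[of _ "1 / 2 ^ 14 :: real"] conjI allI impI)
  fix n m :: nat assume "4 \<le> n" "4 \<le> m"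
  then obtain G :: "(nat, nat) pre_digraph" where G: "oriented_graph G" "card (verts G) = n"
      "card (arcs G) = m" "min (n\<^sup>2) m * min n m + m \<le> 2 ^ 14 * commutativity_rank G"
    using graph_with_large_rank[of n m] by auto
  have "real (min (n\<^sup>2) m * min n m + m) \<le> real (2 ^ 14 * commutativity_rank G)"
    using G(4) by (rule of_nat_mono)
  then have "min (real n ^ 2) (real m) * min (real n) (real m) + real m \<le>
      2 ^ 14 * real (commutativity_rank G)"
    by (simp add: of_nat_min)
  then have "1 / 2 ^ 14 * (min (real n ^ 2) (real m) * min (real n) (real m) + real m) \<le>
      real (commutativity_rank G)" by simp
  with G(1-3) show "\<exists>G :: (nat, nat) pre_digraph.
      oriented_graph G \<and> card (verts G) = n \<and> card (arcs G) = m \<and>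
      real (commutativity_rank G) \<ge>
        1 / 2 ^ 14 * (min (real (card (verts G)) ^ 2) (real (card (arcs G)))
                  * min (real (card (verts G))) (real (card (arcs G)))
                + real (card (arcs G)))"
    by (intro exI[of _ G]) simp
qed simp_all

end
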